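(* Let $F:\mathbb{R}^n\rightrightarrows\mathbb{R}^q$ be a polyhedral convex set-valued mapping and let $C\subseteq\mathbb{R}^q$ be a polyhedral convex cone which has nonempty interior and is free of lines. Suppose problem (P) is feasible and bounded. Then the algorithm $\mathtt{SolveBounded}(F,C)$ is correct and terminates after finitely many steps; that is, after finitely many steps it outputs a set $\bar S$ that is a solution of (P).
   Context: A set-valued mapping $F:\mathbb{R}^n\rightrightarrows\mathbb{R}^q$ is polyhedral convex if its graph $\mathrm{gr}\,F=\{(x,y)\in\mathbb{R}^n\times\mathbb{R}^q : y\in F(x)\}$ is a convex polyhedron; $\mathrm{dom}\,F=\{x : F(x)\ne\emptyset\}$. Polyhedral convex cones are nonempty (contain $0$). Problem (P) is: minimize $F(x)+C$ over $x\in\mathbb{R}^n$ with respect to the ordering $\supseteq$. It is feasible if $\mathrm{dom}\,F\neq\emptyset$, and bounded if there exists a bounded set $L\subseteq\mathbb{R}^q$ such that $L+C\supseteq F(x)$ for all $x\in\mathbb{R}^n$. Its upper image is the convex polyhedron $\mathcal{P}=C+\bigcup_{x\in\mathbb{R}^n}F(x)$; $\mathrm{vert}\,\mathcal{P}$ denotes its set of vertices. A minimizer of (P) is a point $\bar x\in\mathrm{dom}\,F$ such that there is no $x\in\mathbb{R}^n$ with $F(x)+C\supsetneq F(\bar x)+C$. A solution of a bounded problem (P) is a finite set $\bar S\subseteq\mathrm{dom}\,F$ such that $\mathcal{P}=C+\mathrm{conv}\bigcup_{\bar x\in\bar S}F(\bar x)$ and every $\bar x\in\bar S$ is a minimizer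 of (P). Minimal system of outer normals: for a polyhedral convex set $Q\subseteq\mathbb{R}^q$, the family $\{w^1,\dots,w^k\}$ of vectors arising from an inequality representation $Q=\{y : y^Tw^1\le\gamma_1,\dots,y^Tw^k\le\gamma_k\}$ with $\|w^1\|=\dots=\|w^k\|=1$ and $k$ minimal. If $Q$ has nonempty interior, these are the uniquely determined unit outer normals at the facets of $Q$. For $\bar x\in\mathrm{dom}\,F$ and $w\in\mathbb{R}^q$, $\mathrm{LP}(F,w,\bar x)$ is the linear program: maximize $w^Ty$ over $(x,y)\in\mathbb{R}^n\times\mathbb{R}^q$ subject to $y\in F(x)+C$ and $F(\bar x)+C\subseteq F(x)+C$. Procedure $\mathtt{ComputeMinimizer}(F,C,\bar y)$ (for $\bar y\in\mathcal{P}$): 1. Choose $\bar x\in\mathbb{R}^n$ with $\bar y\in F(\bar x)+C$. Let $N$ be the minimal system of outer normals of $F(\bar x)+C$, and let $W=\emptyset$. 2. While $N\not\subseteq W$: choose $w\in N\setminus W$ and replace $W$ by $W\cup\{w\}$. If $\mathrm{LP}(F,w,\bar x)$ has no optimal solution, return $\emptyset$ and stop; otherwise let $(x^*,y^* )$ be an optimal solution. If $y^*\notin F(\bar x)+C$, replace $\bar x$ by $x^*$ and replace $N$ by the minimal system of outer normals of the new set $F(\bar x)+C$. 3. Return $\{\bar x\}$. Algorithm $\mathtt{SolveBounded}(F,C)$: start with $\bar S=\emptyset$; for each $y\in\mathrm{vert}\,\mathcal{P}$ replace $\bar S$ by $\bar S\cup\mathtt{ComputeMinimizer}(F,C,y)$;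 output $\bar S$. (The computation of $\mathrm{vert}\,\mathcal{P}$ is regarded as available.) All choices are arbitrary. *)

theory Defs
  imports "HOL-Analysis.Analysis"
begin

text \<open>
  A set-valued mapping is a function into sets; the sum of two sets is the Minkowski sum of
  \<^theory>\<open>HOL-Library.Set_Algebras\<close>, so that \<open>F x + C\<close> is empty when \<open>F x\<close> is.
\<close>

definition set_graph :: "('x \<Rightarrow> 'y set) \<Rightarrow> ('x \<times> 'y) set" where
  "set_graph F = {(x, y). y \<in> F x}"

definition set_dom :: "('x \<Rightarrow> 'y set) \<Rightarrow> 'x set" where
  "set_dom F = {x. F x \<noteq> {}}"

definition polyhedral_convex_map ::
    "('x::euclidean_space \<Rightarrow> 'y::euclidean_space set) \<Rightarrow> bool" where
  "polyhedral_convex_map F \<longleftrightarrow> polyhedron (set_graph F)"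

definition line_free :: "'y::real_vector set \<Rightarrow> bool" where
  "line_free S \<longleftrightarrow> \<not> (\<exists>a d. d \<noteq> 0 \<and> (\<forall>t::real. a + t *\<^sub>R d \<in> S))"

definition feasible_problem :: "('x \<Rightarrow> 'y set) \<Rightarrow> bool" where
  "feasible_problem F \<longleftrightarrow> set_dom F \<noteq> {}"

definition bounded_problem ::
    "('x \<Rightarrow> 'y::euclidean_space set) \<Rightarrow> 'y set \<Rightarrow> bool" where
  "bounded_problem F C \<longleftrightarrow> (\<exists>L. bounded L \<and> (\<forall>x. F x \<subseteq> L + C))"

definition upper_image ::
    "('x \<Rightarrow> 'y::euclidean_space set) \<Rightarrow> 'y set \<Rightarrow> 'y set" where
  "upper_image F C = C + (\<Union>x. F x)"

definition vertices :: "'y::euclidean_space set \<Rightarrow> 'y set" where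
  "vertices P = {y. y extreme_point_of P}"

definition is_minimizer ::
    "('x \<Rightarrow> 'y::euclidean_space set) \<Rightarrow> 'y set \<Rightarrow> 'x \<Rightarrow> bool" where
  "is_minimizer F C x' \<longleftrightarrow> x' \<in> set_dom F \<and> \<not> (\<exists>x. F x' + C \<subset> F x + C)"

definition is_solution ::
    "('x \<Rightarrow> 'y::euclidean_space set) \<Rightarrow> 'y set \<Rightarrow> 'x set \<Rightarrow> bool" where
  "is_solution F C S \<longleftrightarrow>
     finite S \<and> S \<subseteq> set_dom F \<and>
     upper_image F C = C + convex hull (\<Union>x\<in>S. F x) \<and>
     (\<forall>x\<in>S. is_minimizer F C x)"

definition normal_representation ::
    "'y::euclidean_space set \<Rightarrow> nat \<Rightarrow> (nat \<Rightarrow> 'y) \<Rightarrow> (nat \<Rightarrow> real) \<Rightarrow> bool" where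
  "normal_representation Q k w \<gamma> \<longleftrightarrow>
     Q = {y. \<forall>i<k. y \<bullet> w i \<le> \<gamma> i} \<and> (\<forall>i<k. norm (w i) = 1)"

text \<open>
  A relation rather than a function: without interior points in \<open>Q\<close>, minimal systems need not
  be unique.
\<close>

definition minimal_normal_system :: "'y::euclidean_space set \<Rightarrow> 'y set \<Rightarrow> bool" where
  "minimal_normal_system Q N \<longleftrightarrow>
     (\<exists>k w \<gamma>. normal_representation Q k w \<gamma> \<and> N = w ` {..<k} \<and>
        (\<forall>k' w' \<gamma>'. normal_representation Q k' w' \<gamma>' \<longrightarrow> k \<le> k'))"

definition lp_feasible_set ::
    "('x \<Rightarrow> 'y::euclidean_space set) \<Rightarrow> 'y set \<Rightarrow> 'x \<Rightarrow> ('x \<times> 'y) set" where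
  "lp_feasible_set F C x' = {(x, y). y \<in> F x + C \<and> F x' + C \<subseteq> F x + C}"

definition lp_optimal ::
    "('x \<Rightarrow> 'y::euclidean_space set) \<Rightarrow> 'y set \<Rightarrow> 'y \<Rightarrow> 'x \<Rightarrow> 'x \<times> 'y \<Rightarrow> bool" where
  "lp_optimal F C w x' z \<longleftrightarrow>
     z \<in> lp_feasible_set F C x' \<and>
     (\<forall>(x, y) \<in> lp_feasible_set F C x'. w \<bullet> y \<le> w \<bullet> snd z)"

text \<open>
  Both procedures are nondeterministic transition systems: every arbitrary choice is a separate
  transition, and a state without a successor is one in which the execution has halted.
  In \<open>CM_Loop x N W\<close> the components are the current values of $\bar x$, $N$ and $W$.
\<close>

datatype ('x, 'y) cm_state =
    CM_Start 'y
  | CM_Loop 'x "'y set" "'y set"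
  | CM_Return "'x set"

inductive compute_minimizer_step ::
    "('x \<Rightarrow> 'y::euclidean_space set) \<Rightarrow> 'y set \<Rightarrow> ('x, 'y) cm_state \<Rightarrow> ('x, 'y) cm_state \<Rightarrow> bool"
  for F :: "'x \<Rightarrow> 'y set" and C :: "'y set" where
  cm_init:
    "\<lbrakk>y \<in> F x + C; minimal_normal_system (F x + C) N\<rbrakk>
     \<Longrightarrow> compute_minimizer_step F C (CM_Start y) (CM_Loop x N {})"
| cm_no_optimum:
    "\<lbrakk>w \<in> N - W; \<not> (\<exists>z. lp_optimal F C w x z)\<rbrakk>
     \<Longrightarrow> compute_minimizer_step F C (CM_Loop x N W) (CM_Return {})"
| cm_keep:
    "\<lbrakk>w \<in> N - W; lp_optimal F C w x (x', y'); y' \<in> F x + C\<rbrakk>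
     \<Longrightarrow> compute_minimizer_step F C (CM_Loop x N W) (CM_Loop x N (W \<union> {w}))"
| cm_replace:
    "\<lbrakk>w \<in> N - W; lp_optimal F C w x (x', y'); y' \<notin> F x + C;
      minimal_normal_system (F x' + C) N'\<rbrakk>
     \<Longrightarrow> compute_minimizer_step F C (CM_Loop x N W) (CM_Loop x' N' (W \<union> {w}))"
| cm_return:
    "N \<subseteq> W \<Longrightarrow> compute_minimizer_step F C (CM_Loop x N W) (CM_Return {x})"

text \<open>
  The first component of \<open>SB_Iterate\<close> and \<open>SB_Call\<close> is the set of vertices still to be visited
  (an infinite vertex set would thus give an infinite run), the second is the set of points
  collected so far, and the third component of \<open>SB_Call\<close> is the state of the running call.
\<close>

datatype ('x, 'y) sb_state =
    SB_Iterate "'y set" "'x set"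
  | SB_Call "'y set" "'x set" "('x, 'y) cm_state"
  | SB_Output "'x set"

inductive solve_bounded_step ::
    "('x \<Rightarrow> 'y::euclidean_space set) \<Rightarrow> 'y set \<Rightarrow> ('x, 'y) sb_state \<Rightarrow> ('x, 'y) sb_state \<Rightarrow> bool"
  for F :: "'x \<Rightarrow> 'y set" and C :: "'y set" where
  sb_next:
    "y \<in> V \<Longrightarrow> solve_bounded_step F C (SB_Iterate V S) (SB_Call (V - {y}) S (CM_Start y))"
| sb_call:
    "compute_minimizer_step F C c c'
     \<Longrightarrow> solve_bounded_step F C (SB_Call V S c) (SB_Call V S c')"
| sb_collect:
    "solve_bounded_step F C (SB_Call V S (CM_Return R)) (SB_Iterate V (S \<union> R))"
| sb_output:
    "solve_bounded_step F C (SB_Iterate {} S) (SB_Output S)"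

definition solve_bounded_start ::
    "('x \<Rightarrow> 'y::euclidean_space set) \<Rightarrow> 'y set \<Rightarrow> ('x, 'y) sb_state" where
  "solve_bounded_start F C = SB_Iterate (vertices (upper_image F C)) {}"

end

theory Submission
  imports Defs
begin

text \<open>
  The graph of \<open>x \<mapsto> F x + C\<close> is a polyhedron. Hence all sets \<open>F x + C\<close> are described by
  inequalities whose left-hand sides do not depend on \<open>x\<close>, and since \<open>C\<close> has interior points, all
  minimal systems of outer normals are contained in one finite set of unit vectors. As \<open>W\<close> grows
  within this set, every call terminates. Boundedness of the problem makes each linear program
  bounded, and its feasible set is a polyhedron, so an optimal solution exists. When all facet normals
  of \<open>F x + C\<close> have been processed, no larger \<open>F x' + C\<close> reaches beyond any facet of \<open>F x + C\<close>,
  so \<open>x\<close> is a minimizer. The sets \<open>F x + C\<close> only grow during a call, so the result covers the given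
  vertex, and the upper image, being contained in \<open>L + C\<close> with \<open>L\<close> bounded and \<open>C\<close> free of lines,
  is the sum of \<open>C\<close> and the convex hull of its vertices.
\<close>

subsection \<open>Linear images of polyhedra\<close>

lemma polyhedronE:
  fixes S :: "'a::euclidean_space set"
  assumes "polyhedron S"
  obtains T where "finite T" "\<forall>p\<in>T. fst p \<noteq> 0" "S = {x. \<forall>p\<in>T. fst p \<bullet> x \<le> snd p}"
proof -
  obtain H where H: "finite H" "S = \<Inter>H" "\<forall>h\<in>H. \<exists>a b. a \<noteq> 0 \<and> h = {x. a \<bullet> x \<le> b}"
    using assms unfolding polyhedron_def by blast
  then obtain a b where ab: "\<And>h. h \<in> H \<Longrightarrow> a h \<noteq> 0 \<and> h = {x. a h \<bullet> x \<le> b h}"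
    by metis
  show ?thesis
  proof
    show "finite ((\<lambda>h. (a h, b h)) ` H)" using H(1) by simp
    show "\<forall>p\<in>(\<lambda>h. (a h, b h)) ` H. fst p \<noteq> 0" using ab by auto
    show "S = {x. \<forall>p\<in>(\<lambda>h. (a h, b h)) ` H. fst p \<bullet> x \<le> snd p}"
      using ab H(2) by auto
  qed
qed

lemma polyhedron_inequalities:
  fixes T :: "('a::euclidean_space \<times> real) set"
  assumes "finite T"
  shows "polyhedron {x. \<forall>p\<in>T. fst p \<bullet> x \<le> snd p}"
proof -
  have "{x. \<forall>p\<in>T. fst p \<bullet> x \<le> snd p} = \<Inter>((\<lambda>p. {x. fst p \<bullet> x \<le> snd p}) ` T)"
    by auto
  moreover have "polyhedron \<dots>"
    by (rule polyhedron_Inter) (use assms polyhedron_halfspace_le in auto)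
  ultimately show ?thesis by simp
qed

lemma polyhedron_linear_vimage:
  fixes f :: "'a::euclidean_space \<Rightarrow> 'b::euclidean_space"
  assumes "linear f" "polyhedron S"
  shows "polyhedron (f -` S)"
proof -
  obtain T where T: "finite T" "\<forall>p\<in>T. fst p \<noteq> 0" "S = {x. \<forall>p\<in>T. fst p \<bullet> x \<le> snd p}"
    by (rule polyhedronE[OF assms(2)])
  have "adjoint f a \<bullet> x = a \<bullet> f x" for a x
    by (metis adjoint_works[OF assms(1)] inner_commute)
  then have "f -` S = {x. \<forall>p\<in>(\<lambda>p. (adjoint f (fst p), snd p)) ` T. fst p \<bullet> x \<le> snd p}"
    unfolding T(3) by simp
  moreover have "polyhedron \<dots>"
    by (rule polyhedron_inequalities) (simp add: T(1))
  ultimately show ?thesis by simp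
qed

text \<open>Supplies the value of the eliminated variable in the elimination below; either family of
  bounds may be empty there.\<close>

lemma real_between_finite_sets:
  fixes L U :: "real set"
  assumes "finite L" "finite U" "\<And>l u. l \<in> L \<Longrightarrow> u \<in> U \<Longrightarrow> l \<le> u"
  shows "\<exists>t. (\<forall>l\<in>L. l \<le> t) \<and> (\<forall>u\<in>U. t \<le> u)"
proof (cases "L = {}")
  case True
  then show ?thesis using assms(2) by (cases "U = {}") (auto intro: exI[of _ "Min U"])
next
  case False
  then show ?thesis using assms by (intro exI[of _ "Max L"]) auto
qed

text \<open>Fourier--Motzkin elimination.\<close>

lemma polyhedron_add_line:
  fixes S :: "'a::euclidean_space set"
  assumes "polyhedron S"
  shows "polyhedron {x. \<exists>t::real. x + t *\<^sub>R d \<in> S}"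
proof -
  obtain T where T: "finite T" "\<forall>p\<in>T. fst p \<noteq> 0" "S = {x. \<forall>p\<in>T. fst p \<bullet> x \<le> snd p}"
    by (rule polyhedronE[OF assms])
  define A where "A = {p\<in>T. fst p \<bullet> d > 0}"
  define B where "B = {p\<in>T. fst p \<bullet> d < 0}"
  define Z where "Z = {p\<in>T. fst p \<bullet> d = 0}"
  \<comment> \<open>The positive combination of an upper bound \<open>p\<close> and a lower bound
    \<open>n\<close> in which the component along \<open>d\<close> cancels.\<close>
  define comb where "comb = (\<lambda>(p, n).
    ((fst p \<bullet> d) *\<^sub>R fst n - (fst n \<bullet> d) *\<^sub>R fst p, (fst p \<bullet> d) * snd n - (fst n \<bullet> d) * snd p))"
  have fin: "finite A" "finite B" "finite Z"
    using T(1) unfolding A_def B_def Z_def by auto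
  have "(\<exists>t::real. x + t *\<^sub>R d \<in> S) \<longleftrightarrow> (\<forall>p\<in>Z \<union> comb ` (A \<times> B). fst p \<bullet> x \<le> snd p)" for x
  proof -
    \<comment> \<open>The \<open>t\<close> at which \<open>p\<close> becomes an equality: an upper
      bound on \<open>t\<close> for \<open>p \<in> A\<close>, a lower one for
      \<open>p \<in> B\<close>.\<close>
    define bd where "bd = (\<lambda>p::'a \<times> real. (snd p - fst p \<bullet> x) / (fst p \<bullet> d))"
    have A: "fst p \<bullet> (x + t *\<^sub>R d) \<le> snd p \<longleftrightarrow> t \<le> bd p" if "p \<in> A" for p t
      using that unfolding A_def bd_def by (auto simp: field_simps inner_add_right)
    have B: "fst p \<bullet> (x + t *\<^sub>R d) \<le> snd p \<longleftrightarrow> bd p \<le> t" if "p \<in> B" for p t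
      using that unfolding B_def bd_def by (auto simp: field_simps inner_add_right)
    have Z: "fst p \<bullet> (x + t *\<^sub>R d) \<le> snd p \<longleftrightarrow> fst p \<bullet> x \<le> snd p" if "p \<in> Z" for p t
      using that unfolding Z_def by (auto simp: inner_add_right)
    have AB: "fst (comb (p, n)) \<bullet> x \<le> snd (comb (p, n)) \<longleftrightarrow> bd n \<le> bd p"
      if "p \<in> A" "n \<in> B" for p n
      using that unfolding A_def B_def bd_def comb_def
      by (auto simp: field_simps inner_diff_left)
    have split: "T = Z \<union> A \<union> B"
      unfolding A_def B_def Z_def by auto
    have "(\<exists>t::real. x + t *\<^sub>R d \<in> S) \<longleftrightarrow>
      (\<forall>p\<in>Z. fst p \<bullet> x \<le> snd p) \<and> (\<exists>t. (\<forall>p\<in>A. t \<le> bd p) \<and> (\<forall>n\<in>B. bd n \<le> t))"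
      unfolding T(3) mem_Collect_eq split using A B Z by blast
    also have "(\<exists>t. (\<forall>p\<in>A. t \<le> bd p) \<and> (\<forall>n\<in>B. bd n \<le> t)) \<longleftrightarrow> (\<forall>p\<in>A. \<forall>n\<in>B. bd n \<le> bd p)"
    proof
      show "\<exists>t. (\<forall>p\<in>A. t \<le> bd p) \<and> (\<forall>n\<in>B. bd n \<le> t)" if "\<forall>p\<in>A. \<forall>n\<in>B. bd n \<le> bd p"
      proof -
        have "\<exists>t. (\<forall>l\<in>bd ` B. l \<le> t) \<and> (\<forall>u\<in>bd ` A. t \<le> u)"
          by (rule real_between_finite_sets) (use fin that in auto)
        then show ?thesis by blast
      qed
    qed (meson order_trans)
    also have "\<dots> \<longleftrightarrow> (\<forall>p\<in>comb ` (A \<times> B). fst p \<bullet> x \<le> snd p)"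
      using AB by blast
    finally show ?thesis by blast
  qed
  then show ?thesis
    using polyhedron_inequalities[of "Z \<union> comb ` (A \<times> B)"] fin by auto
qed

lemma polyhedron_add_span:
  fixes S :: "'a::euclidean_space set"
  assumes "polyhedron S" "finite D"
  shows "polyhedron {x. \<exists>v\<in>span D. x + v \<in> S}"
  using assms(2)
proof (induction D rule: finite_induct)
  case empty
  then show ?case using assms(1) by simp
next
  case (insert d D)
  have "(\<exists>v\<in>span (insert d D). x + v \<in> S) \<longleftrightarrow> (\<exists>t. \<exists>v\<in>span D. x + t *\<^sub>R d + v \<in> S)" for x
  proof
    assume "\<exists>v\<in>span (insert d D). x + v \<in> S"
    then obtain v t where "x + v \<in> S" "v - t *\<^sub>R d \<in> span D"
      unfolding span_insert by blast
    then show "\<exists>t. \<exists>v\<in>span D. x + t *\<^sub>R d + v \<in> S"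
      by (intro exI[of _ t] bexI[of _ "v - t *\<^sub>R d"]) auto
  next
    assume "\<exists>t. \<exists>v\<in>span D. x + t *\<^sub>R d + v \<in> S"
    then obtain v t where "x + t *\<^sub>R d + v \<in> S" "v \<in> span D" by blast
    then show "\<exists>v\<in>span (insert d D). x + v \<in> S"
      unfolding span_insert
      by (intro bexI[of _ "t *\<^sub>R d + v"]) (auto simp: add.assoc intro!: exI[of _ t])
  qed
  then show ?case
    using polyhedron_add_line[OF insert.IH, of d] by simp
qed

text \<open>Projecting amounts to adding the subspace of vectors \<open>(0, v)\<close> and then
  taking the slice with second component 0, a linear preimage.\<close>

lemma polyhedron_fst_image:
  fixes S :: "('a::euclidean_space \<times> 'b::euclidean_space) set"
  assumes "polyhedron S"
  shows "polyhedron (fst ` S)"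
proof -
  let ?D = "(Pair 0 ` Basis) :: ('a \<times> 'b) set"
  have D: "span ?D = range (Pair 0)"
    using linear_span_image[of "Pair 0 :: 'b \<Rightarrow> 'a \<times> 'b" Basis]
    by (simp add: linear_iff)
  have lin: "linear (\<lambda>x. (x, 0 :: 'b) :: 'a \<times> 'b)"
    by (simp add: linear_iff)
  have "fst ` S = (\<lambda>x. (x, 0)) -` {x. \<exists>v\<in>span ?D. x + v \<in> S}"
    unfolding D by force
  then show ?thesis
    using polyhedron_linear_vimage[OF lin polyhedron_add_span[OF assms, of ?D]] by simp
qed

text \<open>The image is the first projection of the set of pairs \<open>(f x, x)\<close> with
  \<open>x \<in> S\<close>, an intersection of two linear preimages.\<close>

lemma polyhedron_linear_image:
  fixes f :: "'a::euclidean_space \<Rightarrow> 'b::euclidean_space"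
  assumes "linear f" "polyhedron S"
  shows "polyhedron (f ` S)"
proof -
  let ?g = "\<lambda>z::'b \<times> 'a. fst z - f (snd z)"
  have "linear (snd :: 'b \<times> 'a \<Rightarrow> 'a)" "linear ?g"
    using assms(1) by (auto simp: linear_iff algebra_simps)
  then have "polyhedron (snd -` S \<inter> ?g -` {0})"
    using assms(2) affine_imp_polyhedron[of "{0 :: 'b}"]
    by (intro polyhedron_Int polyhedron_linear_vimage) auto
  moreover have "snd -` S \<inter> ?g -` {0} = (\<lambda>x. (f x, x)) ` S"
    by auto
  then have "f ` S = fst ` (snd -` S \<inter> ?g -` {0})"
    by (simp add: image_image)
  ultimately show ?thesis
    using polyhedron_fst_image by metis
qed

lemma polyhedron_Times:
  fixes S :: "'a::euclidean_space set" and T :: "'b::euclidean_space set"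
  assumes "polyhedron S" "polyhedron T"
  shows "polyhedron (S \<times> T)"
proof -
  have "S \<times> T = fst -` S \<inter> snd -` T" by auto
  moreover have "linear (fst :: 'a \<times> 'b \<Rightarrow> 'a)" "linear (snd :: 'a \<times> 'b \<Rightarrow> 'b)"
    by (auto simp: linear_iff)
  ultimately show ?thesis
    using assms by (simp add: polyhedron_linear_vimage)
qed

text \<open>The image is a polyhedron in the reals, hence closed, and so contains its
  supremum.\<close>

lemma linear_functional_attains_max_on_polyhedron:
  fixes f :: "'a::euclidean_space \<Rightarrow> real"
  assumes "polyhedron S" "S \<noteq> {}" "linear f" "bdd_above (f ` S)"
  shows "\<exists>z\<in>S. \<forall>x\<in>S. f x \<le> f z"
proof -
  have "closed (f ` S)"
    using polyhedron_imp_closed[OF polyhedron_linear_image[OF assms(3,1)]] .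
  then have "Sup (f ` S) \<in> f ` S"
    using assms(2,4) by (intro closed_contains_Sup) auto
  then show ?thesis
    using cSup_upper[OF _ assms(4)] by fastforce
qed

subsection \<open>Minimal systems of outer normals\<close>

lemma minimal_normal_system_exists:
  fixes Q :: "'y::euclidean_space set"
  assumes "polyhedron Q"
  shows "\<exists>N. minimal_normal_system Q N"
proof -
  obtain T where T: "finite T" "\<forall>p\<in>T. fst p \<noteq> 0" "Q = {x. \<forall>p\<in>T. fst p \<bullet> x \<le> snd p}"
    by (rule polyhedronE[OF assms])
  obtain h where h: "bij_betw h {0..<card T} T"
    using ex_bij_betw_nat_finite[OF T(1)] by blast
  have hT: "h ` {..<card T} = T"
    using h by (simp add: bij_betw_def lessThan_atLeast0)
  have "normal_representation Q (card T) (\<lambda>i. fst (h i) /\<^sub>R norm (fst (h i)))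
          (\<lambda>i. snd (h i) / norm (fst (h i)))"
    unfolding normal_representation_def
  proof (intro conjI)
    show "\<forall>i<card T. norm (fst (h i) /\<^sub>R norm (fst (h i))) = 1"
    proof (intro allI impI)
      fix i assume "i < card T"
      then have "fst (h i) \<noteq> 0" using T(2) hT by blast
      then show "norm (fst (h i) /\<^sub>R norm (fst (h i))) = 1" by simp
    qed
    have "(\<forall>p\<in>T. fst p \<bullet> y \<le> snd p) \<longleftrightarrow>
      (\<forall>i<card T. y \<bullet> (fst (h i) /\<^sub>R norm (fst (h i))) \<le> snd (h i) / norm (fst (h i)))" for y
    proof -
      have "fst p \<bullet> y \<le> snd p \<longleftrightarrow> y \<bullet> (fst p /\<^sub>R norm (fst p)) \<le> snd p / norm (fst p)"
        if "p \<in> T" for p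
        using T(2) that by (auto simp: field_simps inner_commute)
      then show ?thesis
        using hT by (smt (verit, best) image_iff lessThan_iff)
    qed
    then show "Q = {y. \<forall>i<card T. y \<bullet> (fst (h i) /\<^sub>R norm (fst (h i))) \<le> snd (h i) / norm (fst (h i))}"
      unfolding T(3) by simp
  qed
  then have ex: "\<exists>k. \<exists>w \<gamma>. normal_representation Q k w \<gamma>" by blast
  define k where "k = (LEAST k. \<exists>w \<gamma>. normal_representation Q k w \<gamma>)"
  obtain w \<gamma> where "normal_representation Q k w \<gamma>"
    using LeastI_ex[OF ex] unfolding k_def by blast
  moreover have "\<forall>k' w' \<gamma>'. normal_representation Q k' w' \<gamma>' \<longrightarrow> k \<le> k'"
    unfolding k_def by (blast intro: Least_le)
  ultimately show ?thesis
    unfolding minimal_normal_system_def by blast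
qed

text \<open>
  At a point \<open>u\<close> where only the \<open>i\<close>-th inequality of the minimal representation is active, \<open>Q\<close>
  looks like a half-space, so every inequality valid on \<open>Q\<close> and active at \<open>u\<close> has a normal that
  is a nonnegative multiple of \<open>w i\<close>.
\<close>

lemma minimal_normal_system_subset:
  fixes Q :: "'y::euclidean_space set"
  assumes "minimal_normal_system Q N" "interior Q \<noteq> {}"
    and "finite T" and Q: "Q = {y. \<forall>p\<in>T. fst p \<bullet> y \<le> snd p}"
  shows "N \<subseteq> (\<lambda>p. fst p /\<^sub>R norm (fst p)) ` T"
proof
  fix n assume "n \<in> N"
  obtain k w \<gamma> where rep: "normal_representation Q k w \<gamma>" and N: "N = w ` {..<k}"
    and min: "\<And>k' w' \<gamma>'. normal_representation Q k' w' \<gamma>' \<Longrightarrow> k \<le> k'"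
    using assms(1) unfolding minimal_normal_system_def by blast
  have Qw: "Q = {y. \<forall>i<k. y \<bullet> w i \<le> \<gamma> i}" and norm_w: "\<And>i. i < k \<Longrightarrow> norm (w i) = 1"
    using rep unfolding normal_representation_def by auto
  obtain i where i: "i < k" "n = w i" using \<open>n \<in> N\<close> N by auto
  have interior_less: "y \<bullet> w j < \<gamma> j" if "y \<in> interior Q" "j < k" for y j
  proof -
    have "interior Q \<subseteq> interior {y. w j \<bullet> y \<le> \<gamma> j}"
      using that(2) unfolding Qw by (intro interior_mono) (auto simp: inner_commute)
    then show ?thesis
      using that norm_w[of j] by (subst (asm) interior_halfspace_le) (auto simp: inner_commute)
  qed
  \<comment> \<open>If the other inequalities implied the \<open>i\<close>-th one, omitting it would
    leave a representation of length \<open>k - 1\<close>.\<close>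
  have "\<exists>z. (\<forall>j<k. j \<noteq> i \<longrightarrow> z \<bullet> w j \<le> \<gamma> j) \<and> z \<bullet> w i > \<gamma> i"
  proof (rule ccontr)
    assume "\<not> ?thesis"
    then have imp: "z \<bullet> w i \<le> \<gamma> i" if "\<forall>j<k. j \<noteq> i \<longrightarrow> z \<bullet> w j \<le> \<gamma> j" for z
      using that by (meson not_le)
    define s where "s = (\<lambda>j::nat. if j < i then j else Suc j)"
    have s: "s j < k \<and> s j \<noteq> i" if "j < k - 1" for j
      using that i(1) unfolding s_def by auto
    have s': "\<exists>j'<k - 1. s j' = j" if "j < k" "j \<noteq> i" for j
      using that i(1) unfolding s_def
      by (intro exI[of _ "if j < i then j else j - 1"]) auto
    have "(\<forall>j<k. y \<bullet> w j \<le> \<gamma> j) \<longleftrightarrow> (\<forall>j<k - 1. y \<bullet> w (s j) \<le> \<gamma> (s j))" for y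
      using s s' imp by metis
    then have "Q = {y. \<forall>j<k - 1. y \<bullet> w (s j) \<le> \<gamma> (s j)}"
      unfolding Qw by simp
    then have "normal_representation Q (k - 1) (w \<circ> s) (\<gamma> \<circ> s)"
      unfolding normal_representation_def using s norm_w by auto
    then show False using min[of "k - 1"] i(1) by fastforce
  qed
  then obtain z where z: "\<And>j. j < k \<Longrightarrow> j \<noteq> i \<Longrightarrow> z \<bullet> w j \<le> \<gamma> j" "z \<bullet> w i > \<gamma> i"
    by blast
  obtain q where q: "q \<in> interior Q" using assms(2) by auto
  \<comment> \<open>The segment from \<open>q\<close> to \<open>z\<close> crosses the
    \<open>i\<close>-th hyperplane here; the other inequalities stay strict at \<open>u\<close>
    because they are strict at \<open>q\<close>.\<close>
  define t where "t = (\<gamma> i - q \<bullet> w i) / (z \<bullet> w i - q \<bullet> w i)"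
  have "q \<bullet> w i < \<gamma> i" using interior_less[OF q i(1)] .
  then have t: "0 < t" "t < 1" "t * (z \<bullet> w i - q \<bullet> w i) = \<gamma> i - q \<bullet> w i"
    using z(2) unfolding t_def by auto
  define u where "u = q + t *\<^sub>R (z - q)"
  have u_i: "u \<bullet> w i = \<gamma> i"
    using t(3) unfolding u_def by (simp add: inner_add_left inner_diff_left)
  have u_j: "u \<bullet> w j < \<gamma> j" if "j < k" "j \<noteq> i" for j
  proof -
    have "u \<bullet> w j = (1 - t) * (q \<bullet> w j) + t * (z \<bullet> w j)"
      unfolding u_def by (simp add: algebra_simps)
    also have "\<dots> < (1 - t) * \<gamma> j + t * \<gamma> j"
      using t(1,2) interior_less[OF q that(1)] z(1)[OF that]
      by (intro add_less_le_mono mult_strict_left_mono mult_left_mono) auto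
    finally show ?thesis by (simp add: algebra_simps)
  qed
  have "u \<bullet> w j \<le> \<gamma> j" if "j < k" for j
    using u_i u_j[OF that] by (cases "j = i") auto
  then have "u \<in> Q" unfolding Qw by simp
  have "open (\<Inter>j\<in>{..<k} - {i}. {y. y \<bullet> w j < \<gamma> j})"
    by (intro open_INT finite_Diff finite_lessThan ballI open_Collect_less continuous_intros)
  moreover have "u \<in> (\<Inter>j\<in>{..<k} - {i}. {y. y \<bullet> w j < \<gamma> j})"
    using u_j by auto
  ultimately obtain e where e: "e > 0" "ball u e \<subseteq> (\<Inter>j\<in>{..<k} - {i}. {y. y \<bullet> w j < \<gamma> j})"
    by (rule openE)
  have halfspace: "\<exists>t>0. u + t *\<^sub>R d \<in> Q" if "w i \<bullet> d \<le> 0" for d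
  proof -
    \<comment> \<open>The summand 1 keeps the denominator positive for \<open>d = 0\<close>.\<close>
    define t where "t = e / (norm d + 1)"
    have t: "t > 0" using e(1) unfolding t_def by (simp add: add_nonneg_pos)
    have "t * norm d < e"
      using e(1) unfolding t_def
      by (simp add: pos_divide_less_eq add_nonneg_pos distrib_left)
    then have "u + t *\<^sub>R d \<in> ball u e" using t by (simp add: dist_norm)
    then have "(u + t *\<^sub>R d) \<bullet> w j < \<gamma> j" if "j < k" "j \<noteq> i" for j
      using e(2) that by blast
    moreover have "(u + t *\<^sub>R d) \<bullet> w i \<le> \<gamma> i"
      using u_i that t
      by (simp add: inner_add_left inner_commute[of d] mult_nonneg_nonpos)
    ultimately have "(u + t *\<^sub>R d) \<bullet> w j \<le> \<gamma> j" if "j < k" for j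
      using that by (cases "j = i") (auto intro: less_imp_le)
    then have "u + t *\<^sub>R d \<in> Q"
      unfolding Qw by simp
    then show ?thesis using t by blast
  qed
  \<comment> \<open>Otherwise \<open>u\<close> would be interior to \<open>Q\<close> although the
    \<open>i\<close>-th inequality is active there. Members of \<open>T\<close> with zero normal
    hold everywhere because they hold at \<open>u\<close>.\<close>
  have "\<exists>p\<in>T. fst p \<noteq> 0 \<and> fst p \<bullet> u = snd p"
  proof (rule ccontr)
    assume "\<not> ?thesis"
    then have act: "fst p \<bullet> u \<noteq> snd p" if "p \<in> T" "fst p \<noteq> 0" for p
      using that by metis
    let ?U = "\<Inter>p\<in>{p\<in>T. fst p \<noteq> 0}. {y. fst p \<bullet> y < snd p}"
    have "open ?U"
      using assms(3) by (intro open_INT ballI open_halfspace_lt) auto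
    moreover have "u \<in> ?U"
      using \<open>u \<in> Q\<close> act unfolding Q by force
    moreover have "?U \<subseteq> Q"
    proof
      fix y assume y: "y \<in> ?U"
      have "fst p \<bullet> y \<le> snd p" if "p \<in> T" for p
      proof (cases "fst p = 0")
        case True
        then show ?thesis using that \<open>u \<in> Q\<close> unfolding Q by force
      next
        case False
        then have "fst p \<bullet> y < snd p" using y that by blast
        then show ?thesis by simp
      qed
      then show "y \<in> Q" unfolding Q by simp
    qed
    ultimately have "u \<in> interior Q" using interior_maximal[of ?U Q] by blast
    then show False using interior_less[OF _ i(1)] u_i by fastforce
  qed
  then obtain p where p: "p \<in> T" "fst p \<noteq> 0" "fst p \<bullet> u = snd p"
    by blast
  have le: "fst p \<bullet> d \<le> 0" if d: "w i \<bullet> d \<le> 0" for d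
  proof -
    obtain t where "t > 0" "u + t *\<^sub>R d \<in> Q" using halfspace[OF d] by blast
    then have "fst p \<bullet> (u + t *\<^sub>R d) \<le> snd p" using p(1) unfolding Q by blast
    then have "t * (fst p \<bullet> d) \<le> 0" using p(3) by (simp add: inner_add_right)
    then show ?thesis using \<open>t > 0\<close> by (simp add: mult_le_0_iff)
  qed
  have ww: "w i \<bullet> w i = 1" using norm_w[OF i(1)] by (simp add: norm_eq_1)
  have "fst p \<bullet> w i \<ge> 0" using le[of "- w i"] ww by simp
  \<comment> \<open>Testing with the component of \<open>fst p\<close> orthogonal to
    \<open>w i\<close> forces equality in Cauchy-Schwarz, so the vectors are parallel.\<close>
  moreover have "fst p \<bullet> (fst p - (fst p \<bullet> w i) *\<^sub>R w i) \<le> 0"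
    using ww by (intro le) (simp add: inner_diff_right inner_commute)
  then have "norm (fst p) ^ 2 \<le> (fst p \<bullet> w i) ^ 2"
    unfolding power2_norm_eq_inner by (simp add: inner_diff_right power2_eq_square)
  ultimately have "norm (fst p) \<le> fst p \<bullet> w i"
    using power2_le_imp_le by blast
  then have "fst p \<bullet> w i = norm (fst p) * norm (w i)"
    using norm_cauchy_schwarz[of "fst p" "w i"] norm_w[OF i(1)] by simp
  then have "norm (fst p) *\<^sub>R w i = fst p"
    using norm_cauchy_schwarz_eq norm_w[OF i(1)] by (metis scaleR_one)
  then have "w i = fst p /\<^sub>R norm (fst p)"
    using p(2) by (metis norm_eq_zero scaleR_scaleR left_inverse scaleR_one)
  then show "n \<in> (\<lambda>p. fst p /\<^sub>R norm (fst p)) ` T"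
    using p(1) i(2) by blast
qed

subsection \<open>Vertices of polyhedra with pointed recession directions\<close>

text \<open>Without lines in \<open>C\<close>, 0 is an extreme point of \<open>C\<close> and thus no
  convex combination of unit vectors of \<open>C\<close>. Separating 0 from their compact hull
  yields \<open>e\<close>.\<close>

lemma line_free_cone_inner_lower_bound:
  fixes C :: "'y::euclidean_space set"
  assumes "closed C" "convex_cone C" "line_free C"
  obtains e :: 'y and \<delta> :: real where "\<delta> > 0" "\<And>c. c \<in> C \<Longrightarrow> \<delta> * norm c \<le> e \<bullet> c"
proof -
  let ?K = "convex hull (C \<inter> sphere 0 1)"
  have conv: "convex C" and cone: "\<And>x c. x \<in> C \<Longrightarrow> 0 \<le> c \<Longrightarrow> c *\<^sub>R x \<in> C" and "0 \<in> C"
    using assms(2) by (auto simp: convex_cone_def conic_def convex_cone_contains_0)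
  have "0 extreme_point_of C"
    unfolding extreme_point_of_def
  proof (intro conjI ballI notI)
    fix a b assume ab: "a \<in> C" "b \<in> C" "0 \<in> open_segment a b"
    then obtain u where u: "a \<noteq> b" "0 < u" "u < 1" "0 = (1 - u) *\<^sub>R a + u *\<^sub>R b"
      by (auto simp: in_segment)
    have neg: "(1 - u) *\<^sub>R a = - (u *\<^sub>R b)"
      using u(4) by (simp add: eq_neg_iff_add_eq_0)
    have "b \<noteq> 0"
      using u neg by auto
    \<comment> \<open>Since \<open>- b\<close> is a positive multiple of \<open>a\<close>, both rays
      along \<open>b\<close> lie in \<open>C\<close>.\<close>
    have "0 + t *\<^sub>R b \<in> C" for t
    proof (cases "t \<ge> 0")
      case True
      then show ?thesis using cone[OF ab(2)] by simp
    next
      case False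
      have "t *\<^sub>R b = (- t / u) *\<^sub>R (- (u *\<^sub>R b))" using u by simp
      also have "\<dots> = (- t / u * (1 - u)) *\<^sub>R a" unfolding neg[symmetric] by simp
      also have "\<dots> \<in> C" using False u by (intro cone[OF ab(1)]) (simp add: divide_nonpos_pos mult_nonpos_nonneg)
      finally show ?thesis by simp
    qed
    then show False using assms(3) \<open>b \<noteq> 0\<close> unfolding line_free_def by blast
  qed (fact \<open>0 \<in> C\<close>)
  moreover have "?K \<subseteq> C"
    using conv by (simp add: hull_minimal)
  ultimately have "0 \<notin> ?K"
    using extreme_point_of_convex_hull[of 0 "C \<inter> sphere 0 1"]
    by (auto simp: extreme_point_of_def)
  moreover have "compact ?K"
    using assms(1) by (intro compact_convex_hull closed_Int_compact) auto
  ultimately obtain e b where e: "0 < b" "\<And>x. x \<in> ?K \<Longrightarrow> e \<bullet> x > b"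
    using separating_hyperplane_closed_0[of ?K] compact_imp_closed by (metis convex_convex_hull)
  have "b * norm c \<le> e \<bullet> c" if "c \<in> C" for c
  proof (cases "c = 0")
    case False
    then have "c /\<^sub>R norm c \<in> C \<inter> sphere 0 1"
      using cone[OF that] by simp
    then have "b < e \<bullet> (c /\<^sub>R norm c)" using e(2) hull_inc by metis
    then show ?thesis using False by (simp add: field_simps)
  qed simp
  then show ?thesis using that e(1) by blast
qed

text \<open>As \<open>a\<close> grows at least at rate \<open>\<delta>\<close> along
  \<open>C\<close>, its sublevel sets in \<open>P\<close> are compact. The minimisers form a compact
  face, whose extreme points are extreme in \<open>P\<close>.\<close>

lemma extreme_point_minimizes_functional:
  fixes P C :: "'y::euclidean_space set"
  assumes "closed P" "convex P" "P \<subseteq> L + C" "bounded L" "y \<in> P"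
    and "\<delta> > 0" "\<And>c. c \<in> C \<Longrightarrow> \<delta> * norm c \<le> a \<bullet> c"
  shows "\<exists>v. v extreme_point_of P \<and> a \<bullet> v \<le> a \<bullet> y"
proof -
  define K where "K = P \<inter> {x. a \<bullet> x \<le> a \<bullet> y}"
  obtain r where r: "\<And>l. l \<in> L \<Longrightarrow> norm l \<le> r"
    using assms(4) by (auto simp: bounded_iff)
  have "norm x \<le> r + (a \<bullet> y + norm a * r) / \<delta>" if "x \<in> K" for x
  proof -
    have "x \<in> L + C" using that assms(3) unfolding K_def by auto
    then obtain l c where x: "x = l + c" "l \<in> L" "c \<in> C"
      unfolding set_plus_def by blast
    have "\<delta> * norm c \<le> a \<bullet> c" using assms(7) x(3) .
    also have "\<dots> = a \<bullet> x - a \<bullet> l" using x(1) by (simp add: inner_add_right)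
    also have "\<dots> \<le> a \<bullet> y + norm a * norm l"
      using abs_le_D2[OF Cauchy_Schwarz_ineq2[of a l]] that unfolding K_def by simp
    also have "\<dots> \<le> a \<bullet> y + norm a * r" using r[OF x(2)] by (simp add: mult_left_mono)
    finally have "norm c \<le> (a \<bullet> y + norm a * r) / \<delta>"
      using assms(6) by (simp add: field_simps)
    then show ?thesis
      using norm_triangle_ineq[of l c] r[OF x(2)] x(1) by simp
  qed
  then have "bounded K" unfolding bounded_iff by blast
  moreover have "closed K"
    unfolding K_def using assms(1) by (intro closed_Int closed_halfspace_le)
  ultimately have "compact K" by (simp add: compact_eq_bounded_closed)
  moreover have "y \<in> K" unfolding K_def using assms(5) by simp
  moreover have "continuous_on K (\<lambda>x. a \<bullet> x)" by (intro continuous_intros)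
  ultimately obtain m where m: "m \<in> K" "\<And>x. x \<in> K \<Longrightarrow> a \<bullet> m \<le> a \<bullet> x"
    using continuous_attains_inf[of K "\<lambda>x. a \<bullet> x"] by blast
  have m_min: "a \<bullet> m \<le> a \<bullet> x" if "x \<in> P" for x
    using m(2)[of x] m(2)[OF \<open>y \<in> K\<close>] that unfolding K_def by fastforce
  define M where "M = P \<inter> {x. a \<bullet> x = a \<bullet> m}"
  have face: "M face_of P"
    unfolding M_def using assms(2) m_min by (intro face_of_Int_supporting_hyperplane_ge)
  have "M = K \<inter> {x. a \<bullet> x = a \<bullet> m}"
    unfolding M_def K_def using m(2)[OF \<open>y \<in> K\<close>] by auto
  then have "compact M"
    using \<open>compact K\<close> by (simp add: compact_Int_closed closed_hyperplane)
  moreover have "M \<noteq> {}" unfolding M_def using m(1) K_def by auto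
  ultimately obtain v where "v extreme_point_of M"
    using extreme_point_exists_convex face_of_imp_convex[OF face] by metis
  then have "v extreme_point_of P" "v \<in> M"
    using extreme_point_of_face[OF face] by auto
  then show ?thesis
    using m(2)[OF \<open>y \<in> K\<close>] unfolding M_def by auto
qed

text \<open>
  A functional \<open>a\<close> separating a point of \<open>P\<close> from the right-hand side is nonnegative on \<open>C\<close>;
  perturbing it by a functional that is positive on \<open>C\<close> makes its minimum over \<open>P\<close>
  attained at an extreme point, which contradicts the separation.
\<close>

lemma polyhedron_subset_extreme_points_plus_cone:
  fixes P C :: "'y::euclidean_space set"
  assumes "polyhedron P" "P \<subseteq> L + C" "bounded L"
    and "closed C" "convex_cone C" "line_free C"
  shows "P \<subseteq> convex hull {v. v extreme_point_of P} + C"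
proof
  fix y assume "y \<in> P"
  let ?V = "{v. v extreme_point_of P}"
  let ?Q = "convex hull ?V + C"
  have P: "closed P" "convex P"
    using assms(1) by (auto intro: polyhedron_imp_closed polyhedron_imp_convex)
  have cone: "convex C" "\<And>x c. x \<in> C \<Longrightarrow> 0 \<le> c \<Longrightarrow> c *\<^sub>R x \<in> C" "0 \<in> C"
    using assms(5) by (auto simp: convex_cone_def conic_def convex_cone_contains_0)
  obtain e \<delta> where e: "\<delta> > 0" "\<And>c. c \<in> C \<Longrightarrow> \<delta> * norm c \<le> e \<bullet> c"
    using line_free_cone_inner_lower_bound[OF assms(4-6)] by blast
  note vertex = extreme_point_minimizes_functional[OF P assms(2,3) \<open>y \<in> P\<close>]
  obtain r where r: "\<And>l. l \<in> L \<Longrightarrow> norm l \<le> r"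
    using assms(3) by (auto simp: bounded_iff)
  show "y \<in> ?Q"
  proof (rule ccontr)
    assume "y \<notin> ?Q"
    \<comment> \<open>Compact plus closed is closed, which permits strict separation.\<close>
    have "compact (convex hull ?V)"
      using finite_polyhedron_extreme_points[OF assms(1)] by (rule finite_imp_compact_convex_hull)
    then have "closed (\<Union>x\<in>convex hull ?V. \<Union>y\<in>C. {x + y})"
      using assms(4) by (rule compact_closed_sums)
    also have "(\<Union>x\<in>convex hull ?V. \<Union>y\<in>C. {x + y}) = ?Q"
      unfolding set_plus_def by auto
    finally have "closed ?Q" .
    moreover have "convex ?Q"
      using cone(1) by (intro convex_set_plus) auto
    ultimately obtain a b where ab: "a \<bullet> y < b" "\<And>q. q \<in> ?Q \<Longrightarrow> a \<bullet> q > b"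
      using separating_hyperplane_closed_point[of ?Q y] \<open>y \<notin> ?Q\<close> by blast
    have VQ: "v + c \<in> ?Q" if "v \<in> ?V" "c \<in> C" for v c
      using that by (intro set_plus_intro hull_inc)
    obtain v0 where v0: "v0 \<in> ?V" using vertex[OF e] by blast
    have nonneg: "a \<bullet> c \<ge> 0" if "c \<in> C" for c
    proof (rule ccontr)
      assume "\<not> a \<bullet> c \<ge> 0"
      then have neg: "a \<bullet> c < 0" by simp
      have "b < a \<bullet> v0" using ab(2)[OF VQ[OF v0 cone(3)]] by simp
      \<comment> \<open>The ray from \<open>v0\<close> along \<open>c\<close> would reach the value
        \<open>b\<close> here, but all values on \<open>?Q\<close> exceed \<open>b\<close>.\<close>
      define t where "t = (b - a \<bullet> v0) / (a \<bullet> c)"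
      have "t \<ge> 0" unfolding t_def using neg \<open>b < a \<bullet> v0\<close> by (simp add: divide_nonpos_neg)
      then have "a \<bullet> (v0 + t *\<^sub>R c) > b"
        using ab(2) VQ[OF v0 cone(2)[OF that]] by blast
      then show False unfolding t_def using neg by (simp add: inner_add_right)
    qed
    \<comment> \<open>Bounds the drop of \<open>e\<close> on \<open>P\<close> below its value at
      \<open>y\<close>: \<open>e\<close> is bounded on \<open>L\<close> and nonnegative on
      \<open>C\<close>.\<close>
    define k where "k = e \<bullet> y + norm e * r"
    have k: "e \<bullet> y - e \<bullet> x \<le> k" if "x \<in> P" for x
    proof -
      have "x \<in> L + C" using that assms(2) by auto
      then obtain l c where x: "x = l + c" "l \<in> L" "c \<in> C"
        unfolding set_plus_def by blast
      have "- (e \<bullet> l) \<le> norm e * norm l"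
        using Cauchy_Schwarz_ineq2[of e l] by linarith
      also have "\<dots> \<le> norm e * r" using r[OF x(2)] by (simp add: mult_left_mono)
      finally have "- (e \<bullet> l) \<le> norm e * r" .
      moreover have "0 \<le> e \<bullet> c"
        using e(2)[OF x(3)] e(1) by (meson mult_nonneg_nonneg norm_ge_zero less_imp_le order_trans)
      ultimately show ?thesis unfolding k_def x(1) by (simp add: inner_add_right)
    qed
    have "k \<ge> 0" using k[OF \<open>y \<in> P\<close>] by simp
    \<comment> \<open>Small enough that the perturbation cannot use up the gap
      \<open>b - a \<bullet> y\<close>; the summand 1 gives strictness and covers
      \<open>k = 0\<close>.\<close>
    define \<epsilon> where "\<epsilon> = (b - a \<bullet> y) / (k + 1)"
    have \<epsilon>: "\<epsilon> > 0" "\<epsilon> * k < b - a \<bullet> y"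
      unfolding \<epsilon>_def using ab(1) \<open>k \<ge> 0\<close> by (auto simp: field_simps)
    have "\<epsilon> * \<delta> * norm c \<le> (a + \<epsilon> *\<^sub>R e) \<bullet> c" if "c \<in> C" for c
    proof -
      have "\<epsilon> * (\<delta> * norm c) \<le> \<epsilon> * (e \<bullet> c)"
        using e(2)[OF that] \<epsilon>(1) by (intro mult_left_mono) auto
      then show ?thesis using nonneg[OF that] by (simp add: inner_add_left mult.assoc)
    qed
    moreover have "\<epsilon> * \<delta> > 0" using \<epsilon>(1) e(1) by simp
    ultimately obtain v where v: "v \<in> ?V" "(a + \<epsilon> *\<^sub>R e) \<bullet> v \<le> (a + \<epsilon> *\<^sub>R e) \<bullet> y"
      using vertex[of "\<epsilon> * \<delta>" "a + \<epsilon> *\<^sub>R e"] by blast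
    have "a \<bullet> v - a \<bullet> y \<le> \<epsilon> * (e \<bullet> y - e \<bullet> v)"
      using v(2) by (simp add: inner_add_left right_diff_distrib)
    also have "\<dots> \<le> \<epsilon> * k"
      using k[of v] v(1) \<epsilon>(1) by (intro mult_left_mono) (auto simp: extreme_point_of_def)
    also have "\<dots> < b - a \<bullet> y" by (fact \<epsilon>(2))
    finally show False
      using ab(2)[OF VQ[OF v(1) cone(3)]] by simp
  qed
qed

subsection \<open>Correctness and termination\<close>

locale bounded_polyhedral_problem =
  fixes F :: "'x::euclidean_space \<Rightarrow> 'y::euclidean_space set" and C :: "'y set"
  assumes F: "polyhedral_convex_map F"
    and C: "polyhedron C" "convex_cone C" "interior C \<noteq> {}" "line_free C"
    and bounded: "bounded_problem F C"
begin

section \<open>Polyhedrality of the graph, the values and the upper image\<close>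

lemma C_zero: "0 \<in> C"
  using C(2) by (simp add: convex_cone_contains_0)

lemma C_plus_C: "C + C = C"
proof
  show "C + C \<subseteq> C"
    using convex_cone_add[OF C(2)] by (auto elim!: set_plus_elim)
  show "C \<subseteq> C + C"
    using set_zero_plus2[OF C_zero] .
qed

lemma polyhedron_graph_plus_C: "polyhedron (set_graph (\<lambda>x. F x + C))"
proof -
  let ?f = "\<lambda>z :: ('x \<times> 'y) \<times> 'y. (fst (fst z), snd (fst z) + snd z)"
  have "linear ?f" by (simp add: linear_iff scaleR_right_distrib)
  moreover have "polyhedron (set_graph F \<times> C)"
    using F C(1) unfolding polyhedral_convex_map_def by (rule polyhedron_Times)
  moreover have "set_graph (\<lambda>x. F x + C) = ?f ` (set_graph F \<times> C)"
    unfolding set_graph_def set_plus_def by force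
  ultimately show ?thesis
    using polyhedron_linear_image[of ?f "set_graph F \<times> C"] by simp
qed

lemma upper_image_eq: "upper_image F C = (\<Union>x. F x + C)"
  unfolding upper_image_def set_plus_def by (fastforce simp: add.commute)

lemma polyhedron_upper_image: "polyhedron (upper_image F C)"
proof -
  have "upper_image F C = snd ` set_graph (\<lambda>x. F x + C)"
    unfolding upper_image_eq set_graph_def by force
  moreover have "linear (snd :: 'x \<times> 'y \<Rightarrow> 'y)" by (simp add: linear_iff)
  ultimately show ?thesis
    using polyhedron_linear_image[OF _ polyhedron_graph_plus_C] by simp
qed

text \<open>Fixing \<open>x\<close> in the inequalities of the graph moves their \<open>x\<close>
  part to the right. The common normals later give both a finite set of outer normals and a linear
  form of the inclusion constraint.\<close>

lemma plus_C_inequalities: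
  obtains T :: "(('x \<times> 'y) \<times> real) set" where "finite T"
    "\<And>x. F x + C = {y. \<forall>p\<in>T. snd (fst p) \<bullet> y \<le> snd p - fst (fst p) \<bullet> x}"
proof -
  obtain T where T: "finite T" "\<forall>p\<in>T. fst p \<noteq> 0"
    "set_graph (\<lambda>x. F x + C) = {z. \<forall>p\<in>T. fst p \<bullet> z \<le> snd p}"
    by (rule polyhedronE[OF polyhedron_graph_plus_C])
  have "F x + C = {y. \<forall>p\<in>T. snd (fst p) \<bullet> y \<le> snd p - fst (fst p) \<bullet> x}" for x
  proof -
    have "y \<in> F x + C \<longleftrightarrow> (x, y) \<in> set_graph (\<lambda>x. F x + C)" for y
      by (simp add: set_graph_def)
    then show ?thesis
      unfolding T(3) by (auto simp: inner_prod_def algebra_simps)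
  qed
  then show ?thesis using T(1) that by blast
qed

lemma polyhedron_plus_C: "polyhedron (F x + C)"
proof -
  have "F x + C = snd ` (set_graph (\<lambda>x. F x + C) \<inter> fst -` {x})"
    unfolding set_graph_def by force
  moreover have "linear (fst :: 'x \<times> 'y \<Rightarrow> 'x)" "linear (snd :: 'x \<times> 'y \<Rightarrow> 'y)"
    by (auto simp: linear_iff)
  moreover have "polyhedron {x}" by (simp add: affine_imp_polyhedron)
  ultimately show ?thesis
    using polyhedron_graph_plus_C
    by (simp add: polyhedron_linear_image polyhedron_linear_vimage)
qed

section \<open>Finiteness of the set of outer normals\<close>

lemma interior_plus_C:
  assumes "x \<in> set_dom F"
  shows "interior (F x + C) \<noteq> {}"
proof -
  obtain y where "y \<in> F x" using assms unfolding set_dom_def by blast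
  then have "(+) y ` C \<subseteq> F x + C" by auto
  then have "interior ((+) y ` C) \<subseteq> interior (F x + C)" by (rule interior_mono)
  then show ?thesis using C(3) by (auto simp: interior_translation)
qed

lemma finite_normals:
  obtains B where "finite B"
    "\<And>x N. x \<in> set_dom F \<Longrightarrow> minimal_normal_system (F x + C) N \<Longrightarrow> N \<subseteq> B"
proof -
  obtain T :: "(('x \<times> 'y) \<times> real) set" where T: "finite T"
    "\<And>x. F x + C = {y. \<forall>p\<in>T. snd (fst p) \<bullet> y \<le> snd p - fst (fst p) \<bullet> x}"
    by (rule plus_C_inequalities) blast
  let ?B = "(\<lambda>p. snd (fst p) /\<^sub>R norm (snd (fst p))) ` T"
  have "N \<subseteq> ?B" if "x \<in> set_dom F" "minimal_normal_system (F x + C) N" for x N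
  proof -
    let ?T = "(\<lambda>p. (snd (fst p), snd p - fst (fst p) \<bullet> x)) ` T"
    have "N \<subseteq> (\<lambda>p. fst p /\<^sub>R norm (fst p)) ` ?T"
    proof (rule minimal_normal_system_subset[OF that(2) interior_plus_C[OF that(1)]])
      show "finite ?T" using T(1) by simp
      show "F x + C = {y. \<forall>p\<in>?T. fst p \<bullet> y \<le> snd p}" unfolding T(2)[of x] by simp
    qed
    then show ?thesis by (simp add: image_image)
  qed
  then show ?thesis using that T(1) by blast
qed

section \<open>Solvability of the linear programs\<close>

lemma normal_nonpos_on_C:
  assumes "x \<in> set_dom F" "minimal_normal_system (F x + C) N" "w \<in> N" "c \<in> C"
  shows "w \<bullet> c \<le> 0"
proof (rule ccontr)
  assume "\<not> w \<bullet> c \<le> 0"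
  then have pos: "w \<bullet> c > 0" by simp
  obtain \<gamma> where \<gamma>: "\<And>y. y \<in> F x + C \<Longrightarrow> y \<bullet> w \<le> \<gamma>"
    using assms(2,3) unfolding minimal_normal_system_def normal_representation_def by blast
  obtain y where y: "y \<in> F x" using assms(1) unfolding set_dom_def by blast
  \<comment> \<open>Moving this far along \<open>c\<close> adds
    \<open>\<bar>\<gamma> - w \<bullet> y\<bar> + 1\<close> to \<open>w \<bullet> y\<close> and so
    passes the bound \<open>\<gamma>\<close>.\<close>
  define t where "t = (\<bar>\<gamma> - w \<bullet> y\<bar> + 1) / (w \<bullet> c)"
  have "t \<ge> 0" unfolding t_def using pos by simp
  then have "y + t *\<^sub>R c \<in> F x + C"
    using y convex_cone_scaleR[OF C(2) _ assms(4)] by (intro set_plus_intro)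
  then have "w \<bullet> y + t * (w \<bullet> c) \<le> \<gamma>"
    using \<gamma>[of "y + t *\<^sub>R c"] by (simp add: inner_commute[of _ w] inner_add_right)
  then show False using pos unfolding t_def by simp
qed

text \<open>The inclusion constraint is linear in \<open>x\<close>: for each common normal it
  compares a bound affine in \<open>x\<close> with a constant, the support value of
  \<open>F x' + C\<close>.\<close>

lemma polyhedron_lp_feasible_set:
  assumes "x' \<in> set_dom F"
  shows "polyhedron (lp_feasible_set F C x')"
proof -
  obtain T :: "(('x \<times> 'y) \<times> real) set" where T: "finite T"
    "\<And>x. F x + C = {y. \<forall>p\<in>T. snd (fst p) \<bullet> y \<le> snd p - fst (fst p) \<bullet> x}"
    by (rule plus_C_inequalities) blast
  define s where "s = (\<lambda>p :: ('x \<times> 'y) \<times> real. SUP y\<in>F x' + C. snd (fst p) \<bullet> y)"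
  have ne: "F x' + C \<noteq> {}"
    using assms C_zero unfolding set_dom_def by (auto simp: set_plus_def)
  have "F x' + C \<subseteq> F x + C \<longleftrightarrow> (\<forall>p\<in>T. s p \<le> snd p - fst (fst p) \<bullet> x)" for x
  proof -
    have bdd: "bdd_above ((\<lambda>y. snd (fst p) \<bullet> y) ` (F x' + C))" if "p \<in> T" for p
      using that unfolding T(2)[of x'] by (intro bdd_aboveI2[of _ _ "snd p - fst (fst p) \<bullet> x'"]) simp
    have "s p \<le> snd p - fst (fst p) \<bullet> x \<longleftrightarrow>
        (\<forall>y\<in>F x' + C. snd (fst p) \<bullet> y \<le> snd p - fst (fst p) \<bullet> x)" if "p \<in> T" for p
      unfolding s_def using cSUP_le_iff[OF ne bdd[OF that]] .
    then show ?thesis unfolding T(2)[of x] by blast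
  qed
  then have "lp_feasible_set F C x' =
      set_graph (\<lambda>x. F x + C) \<inter> fst -` {x. \<forall>p\<in>T. s p \<le> snd p - fst (fst p) \<bullet> x}"
    unfolding lp_feasible_set_def set_graph_def by auto
  moreover have "{x. \<forall>p\<in>T. s p \<le> snd p - fst (fst p) \<bullet> x} =
      {x. \<forall>p\<in>(\<lambda>p. (fst (fst p), snd p - s p)) ` T. fst p \<bullet> x \<le> snd p}"
    by (auto simp: algebra_simps)
  moreover have "polyhedron \<dots>"
    by (rule polyhedron_inequalities) (simp add: T(1))
  moreover have "linear (fst :: 'x \<times> 'y \<Rightarrow> 'x)" by (simp add: linear_iff)
  ultimately show ?thesis
    using polyhedron_linear_vimage[of "fst :: 'x \<times> 'y \<Rightarrow> 'x"
        "{x. \<forall>p\<in>T. s p \<le> snd p - fst (fst p) \<bullet> x}"]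
      polyhedron_graph_plus_C by simp
qed

text \<open>Every value lies in \<open>L + C\<close> and \<open>w\<close> is nonpositive on
  \<open>C\<close>, so the objective is bounded by its values on \<open>L\<close>; \<open>x\<close>
  itself gives a feasible point.\<close>

lemma lp_optimal_exists:
  assumes "x \<in> set_dom F" "\<And>c. c \<in> C \<Longrightarrow> w \<bullet> c \<le> 0"
  shows "\<exists>z. lp_optimal F C w x z"
proof -
  obtain L where L: "bounded L" "\<And>x. F x \<subseteq> L + C"
    using bounded unfolding bounded_problem_def by blast
  obtain r where r: "\<And>l. l \<in> L \<Longrightarrow> norm l \<le> r"
    using L(1) by (auto simp: bounded_iff)
  have le: "w \<bullet> y \<le> norm w * r" if "y \<in> F x + C" for x y
  proof -
    have "F x + C \<subseteq> (L + C) + C" using L(2) by (rule set_plus_mono2) simp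
    also have "\<dots> = L + C" by (simp add: add.assoc C_plus_C)
    finally obtain l c where y: "y = l + c" "l \<in> L" "c \<in> C"
      using \<open>y \<in> F x + C\<close> by (meson set_plus_elim subsetD)
    have "w \<bullet> y \<le> w \<bullet> l" using assms(2)[OF y(3)] y(1) by (simp add: inner_add_right)
    also have "\<dots> \<le> norm w * norm l" by (rule norm_cauchy_schwarz)
    also have "\<dots> \<le> norm w * r" using r[OF y(2)] by (simp add: mult_left_mono)
    finally show ?thesis .
  qed
  let ?f = "\<lambda>z :: 'x \<times> 'y. w \<bullet> snd z"
  obtain y where "y \<in> F x" using assms(1) unfolding set_dom_def by blast
  then have "(x, y + 0) \<in> lp_feasible_set F C x"
    unfolding lp_feasible_set_def using C_zero by (simp del: add_0_right add: set_plus_intro)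
  then have "lp_feasible_set F C x \<noteq> {}" by blast
  moreover have "linear ?f" by (simp add: linear_iff inner_add_right)
  moreover have "bdd_above (?f ` lp_feasible_set F C x)"
    using le unfolding lp_feasible_set_def by (auto intro!: bdd_aboveI2[of _ _ "norm w * r"])
  ultimately obtain z where "z \<in> lp_feasible_set F C x"
      "\<forall>z'\<in>lp_feasible_set F C x. ?f z' \<le> ?f z"
    using linear_functional_attains_max_on_polyhedron[OF polyhedron_lp_feasible_set[OF assms(1)]]
    by blast
  then show ?thesis
    by (intro exI[of _ z]) (auto simp: lp_optimal_def)
qed

section \<open>Vertices of the upper image and solutions\<close>

lemma mem_plus_C_imp_dom: "y \<in> F x + C \<Longrightarrow> x \<in> set_dom F"
  unfolding set_dom_def by (auto simp: set_plus_def)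

lemma plus_C_imp_upper_image: "F x + C \<subseteq> upper_image F C"
  unfolding upper_image_eq by blast

text \<open>Boundedness puts the upper image into \<open>L + C + C = L + C\<close>, so the extreme
  point result applies. The converse uses convexity and invariance under adding
  \<open>C\<close>.\<close>

lemma upper_image_eq_hull_vertices:
  "upper_image F C = convex hull (vertices (upper_image F C)) + C"
proof
  obtain L where L: "bounded L" "\<And>x. F x \<subseteq> L + C"
    using bounded unfolding bounded_problem_def by blast
  have "F x + C \<subseteq> (L + C) + C" for x using L(2) by (rule set_plus_mono2) simp
  then have "upper_image F C \<subseteq> L + C"
    unfolding upper_image_eq by (simp add: add.assoc C_plus_C UN_least)
  then show "upper_image F C \<subseteq> convex hull (vertices (upper_image F C)) + C"
    unfolding vertices_def
    using polyhedron_subset_extreme_points_plus_cone polyhedron_upper_image L(1)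
      polyhedron_imp_closed[OF C(1)] C(2,4) by blast
  have "convex hull (vertices (upper_image F C)) \<subseteq> upper_image F C"
    using polyhedron_imp_convex[OF polyhedron_upper_image]
    by (intro hull_minimal) (auto simp: vertices_def extreme_point_of_def)
  then have "convex hull (vertices (upper_image F C)) + C \<subseteq> upper_image F C + C"
    by (rule set_plus_mono2) simp
  also have "\<dots> = upper_image F C"
    unfolding upper_image_def by (metis C_plus_C add.assoc add.commute)
  finally show "convex hull (vertices (upper_image F C)) + C \<subseteq> upper_image F C" .
qed

text \<open>Covering the vertices suffices because hulls commute with Minkowski sums and
  \<open>C + C = C\<close>.\<close>

lemma is_solutionI:
  assumes "finite S" "\<And>x. x \<in> S \<Longrightarrow> is_minimizer F C x"
    and "\<And>y. y \<in> vertices (upper_image F C) \<Longrightarrow> \<exists>x\<in>S. y \<in> F x + C"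
  shows "is_solution F C S"
proof -
  let ?H = "convex hull (\<Union>x\<in>S. F x)"
  have "vertices (upper_image F C) \<subseteq> (\<Union>x\<in>S. F x) + C"
    using assms(3) by (fastforce simp: set_plus_def)
  then have "convex hull (vertices (upper_image F C)) \<subseteq> convex hull ((\<Union>x\<in>S. F x) + C)"
    by (rule hull_mono)
  also have "\<dots> = ?H + C"
    using C(1) by (simp add: convex_hull_set_plus hull_same polyhedron_imp_convex)
  finally have "upper_image F C \<subseteq> (?H + C) + C"
    by (subst upper_image_eq_hull_vertices) (rule set_plus_mono2, simp_all)
  also have "(?H + C) + C = C + ?H"
    by (simp add: add.assoc C_plus_C) (rule add.commute)
  finally have "upper_image F C \<subseteq> C + ?H" .
  moreover have "?H \<subseteq> upper_image F C"
  proof (intro hull_minimal UN_least)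
    show "F x \<subseteq> upper_image F C" for x
      using plus_C_imp_upper_image[of x] C_zero by (force simp: set_plus_def)
  qed (use polyhedron_imp_convex[OF polyhedron_upper_image] in simp)
  then have "C + ?H \<subseteq> C + upper_image F C"
    by (intro set_plus_mono2) simp_all
  then have "C + ?H \<subseteq> upper_image F C"
    unfolding upper_image_def by (simp add: C_plus_C flip: add.assoc)
  ultimately show ?thesis
    unfolding is_solution_def using assms(1,2) by (auto simp: is_minimizer_def)
qed

text \<open>
  The loop invariant is that all directions in \<open>W\<close> are saturated; it survives a replacement of
  \<open>x\<close> because the sets \<open>F x + C\<close> only grow.
\<close>

definition saturated :: "'x \<Rightarrow> 'y \<Rightarrow> bool" where
  "saturated x w \<longleftrightarrow>
     (\<forall>x'. F x + C \<subseteq> F x' + C \<longrightarrow> (\<forall>y'\<in>F x' + C. \<exists>y\<in>F x + C. w \<bullet> y' \<le> w \<bullet> y))"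

lemma saturated_mono:
  assumes "saturated x w" "F x + C \<subseteq> F x' + C"
  shows "saturated x' w"
  using assms unfolding saturated_def by (meson order_trans subsetD)

text \<open>Any value containing \<open>F z + C\<close> is feasible for the program at
  \<open>x\<close>, so \<open>w \<bullet> y'\<close> bounds it. The free \<open>z\<close> serves
  both branches: \<open>z = x\<close> on keeping, \<open>z = x'\<close> on replacing.\<close>

lemma lp_optimal_imp_saturated:
  assumes "lp_optimal F C w x (x', y')" "F x + C \<subseteq> F z + C" "y' \<in> F z + C"
  shows "saturated z w"
  unfolding saturated_def
proof (intro allI impI ballI)
  fix v u assume "F z + C \<subseteq> F v + C" "u \<in> F v + C"
  then have "(v, u) \<in> lp_feasible_set F C x"
    using assms(2) unfolding lp_feasible_set_def by auto
  then have "w \<bullet> u \<le> w \<bullet> y'" using assms(1) unfolding lp_optimal_def by auto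
  then show "\<exists>y\<in>F z + C. w \<bullet> u \<le> w \<bullet> y" using assms(3) by blast
qed

text \<open>Saturation carries each inequality of the representation over to any larger value, which
  is therefore not strictly larger.\<close>

lemma saturated_imp_minimizer:
  assumes "x \<in> set_dom F" "minimal_normal_system (F x + C) N" "\<And>w. w \<in> N \<Longrightarrow> saturated x w"
  shows "is_minimizer F C x"
  unfolding is_minimizer_def
proof (intro conjI notI)
  assume "\<exists>x'. F x + C \<subset> F x' + C"
  then obtain x' where x': "F x + C \<subset> F x' + C" by blast
  obtain k w \<gamma> where Q: "F x + C = {y. \<forall>i<k. y \<bullet> w i \<le> \<gamma> i}" and N: "N = w ` {..<k::nat}"
    using assms(2) unfolding minimal_normal_system_def normal_representation_def by blast
  have "y' \<in> F x + C" if "y' \<in> F x' + C" for y'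
  proof -
    have "y' \<bullet> w i \<le> \<gamma> i" if "i < k" for i
    proof -
      obtain y where "y \<in> F x + C" "w i \<bullet> y' \<le> w i \<bullet> y"
        using assms(3)[of "w i"] x' \<open>y' \<in> F x' + C\<close> \<open>i < k\<close> N unfolding saturated_def by blast
      then show ?thesis using \<open>i < k\<close> unfolding Q by (force simp: inner_commute)
    qed
    then show ?thesis unfolding Q by simp
  qed
  then show False using x' by blast
qed (fact assms(1))

text \<open>Here \<open>y\<close> is the vertex that started the call. The last clause excludes an
  empty result, so invariance includes that the branch without optimum is never taken.\<close>

fun cm_inv :: "'y set \<Rightarrow> 'y \<Rightarrow> ('x, 'y) cm_state \<Rightarrow> bool" where
  "cm_inv B y (CM_Start y') \<longleftrightarrow> y' = y"
| "cm_inv B y (CM_Loop x N W) \<longleftrightarrow> y \<in> F x + C \<and> minimal_normal_system (F x + C) N \<and>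
     W \<subseteq> B \<and> (\<forall>w\<in>W. saturated x w)"
| "cm_inv B y (CM_Return R) \<longleftrightarrow> (\<exists>x. R = {x} \<and> y \<in> F x + C \<and> is_minimizer F C x)"

text \<open>A loop value is positive as long as \<open>card W \<le> card B\<close>, so returning
  decreases it; a start exceeds the loop with empty \<open>W\<close> by 1.\<close>

fun cm_measure :: "'y set \<Rightarrow> ('x, 'y) cm_state \<Rightarrow> nat" where
  "cm_measure B (CM_Start y) = card B + 2"
| "cm_measure B (CM_Loop x N W) = card B + 1 - card W"
| "cm_measure B (CM_Return R) = 0"

text \<open>The vertex of a running call is quantified because the state does not keep it after the
  start; it need not be covered yet.\<close>

fun sb_inv :: "'y set \<Rightarrow> ('x, 'y) sb_state \<Rightarrow> bool" where
  "sb_inv B (SB_Iterate V S) \<longleftrightarrow> V \<subseteq> vertices (upper_image F C) \<and> finite S \<and>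
     (\<forall>x\<in>S. is_minimizer F C x) \<and>
     (\<forall>y\<in>vertices (upper_image F C) - V. \<exists>x\<in>S. y \<in> F x + C)"
| "sb_inv B (SB_Call V S c) \<longleftrightarrow> V \<subseteq> vertices (upper_image F C) \<and> finite S \<and>
     (\<forall>x\<in>S. is_minimizer F C x) \<and>
     (\<exists>y\<in>vertices (upper_image F C). cm_inv B y c \<and>
       (\<forall>y'\<in>vertices (upper_image F C) - V - {y}. \<exists>x\<in>S. y' \<in> F x + C))"
| "sb_inv B (SB_Output S) \<longleftrightarrow> is_solution F C S"

text \<open>
  A vertex has weight \<open>card B + 5\<close> because a call starts with the summand \<open>card B + 4\<close> and must
  be paid for by the removal of its vertex.
\<close>

fun sb_measure :: "'y set \<Rightarrow> ('x, 'y) sb_state \<Rightarrow> nat" where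
  "sb_measure B (SB_Iterate V S) = card V * (card B + 5) + 1"
| "sb_measure B (SB_Call V S c) = card V * (card B + 5) + 2 + cm_measure B c"
| "sb_measure B (SB_Output S) = 0"

section \<open>Progress, invariance and decrease of the measures\<close>

lemma finite_vertices: "finite (vertices (upper_image F C))"
  unfolding vertices_def using finite_polyhedron_extreme_points[OF polyhedron_upper_image] .

lemma cm_progress:
  assumes "y \<in> upper_image F C" "cm_inv B y c" "\<And>R. c \<noteq> CM_Return R"
  shows "\<exists>c'. compute_minimizer_step F C c c'"
proof (cases c)
  case (CM_Start y')
  then obtain x where "y' \<in> F x + C" using assms(1,2) unfolding upper_image_eq by auto
  then show ?thesis
    using minimal_normal_system_exists[OF polyhedron_plus_C] cm_init CM_Start by metis
next
  case (CM_Loop x N W)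
  show ?thesis
  proof (cases "N \<subseteq> W")
    case True
    then show ?thesis using cm_return CM_Loop by metis
  next
    case False
    then obtain w where w: "w \<in> N - W" by blast
    show ?thesis
    proof (cases "\<exists>z. lp_optimal F C w x z")
      case True
      then obtain x' y' where "lp_optimal F C w x (x', y')" by force
      then show ?thesis
        using minimal_normal_system_exists[OF polyhedron_plus_C[of x']] cm_keep cm_replace w CM_Loop
        by metis
    next
      case False
      then show ?thesis using cm_no_optimum w CM_Loop by metis
    qed
  qed
qed (use assms(3) in blast)

lemma sb_progress:
  assumes "sb_inv B \<sigma>" "\<And>\<sigma>'. \<not> solve_bounded_step F C \<sigma> \<sigma>'"
  shows "\<exists>S. \<sigma> = SB_Output S \<and> is_solution F C S"
proof (cases \<sigma>)
  case (SB_Iterate V S)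
  then show ?thesis using assms(2) sb_next sb_output by (metis ex_in_conv)
next
  case (SB_Call V S c)
  obtain y where "y \<in> vertices (upper_image F C)" "cm_inv B y c"
    using assms(1) SB_Call by auto
  moreover have "y \<in> upper_image F C"
    using \<open>y \<in> vertices _\<close> unfolding vertices_def extreme_point_of_def by blast
  ultimately show ?thesis
    using cm_progress[of y B c] assms(2) sb_call sb_collect SB_Call by metis
next
  case (SB_Output S)
  then show ?thesis using assms(1) by simp
qed

context
  fixes B :: "'y set"
  assumes B: "finite B"
    "\<And>x N. x \<in> set_dom F \<Longrightarrow> minimal_normal_system (F x + C) N \<Longrightarrow> N \<subseteq> B"
begin

lemma cm_step_inv:
  assumes "compute_minimizer_step F C c c'" "cm_inv B y c"
  shows "cm_inv B y c'"
  using assms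
proof cases
  case (cm_init y' x N)
  then show ?thesis using assms(2) by simp
next
  \<comment> \<open>Contradictory case: outer normals are nonpositive on \<open>C\<close>, so an
    optimum exists.\<close>
  case (cm_no_optimum w N W x)
  then have inv: "y \<in> F x + C" "minimal_normal_system (F x + C) N"
    using assms(2) by auto
  have dom: "x \<in> set_dom F" using mem_plus_C_imp_dom[OF inv(1)] .
  have "w \<bullet> c \<le> 0" if "c \<in> C" for c
    using normal_nonpos_on_C[OF dom inv(2) _ that] cm_no_optimum(3) by blast
  then show ?thesis using lp_optimal_exists[OF dom] cm_no_optimum(4) by blast
next
  case (cm_keep w N W x x' y')
  then have inv: "y \<in> F x + C" "minimal_normal_system (F x + C) N"
    "W \<subseteq> B" "\<forall>w\<in>W. saturated x w"
    using assms(2) by auto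
  have "w \<in> B" using B(2)[OF mem_plus_C_imp_dom[OF inv(1)] inv(2)] cm_keep(3) by blast
  moreover have "saturated x w"
    using lp_optimal_imp_saturated[OF cm_keep(4) order_refl cm_keep(5)] .
  ultimately show ?thesis using inv cm_keep(2) by simp
next
  case (cm_replace w N W x x' y' N')
  then have inv: "y \<in> F x + C" "minimal_normal_system (F x + C) N"
    "W \<subseteq> B" "\<forall>w\<in>W. saturated x w"
    using assms(2) by auto
  have x': "y' \<in> F x' + C" "F x + C \<subseteq> F x' + C"
    using cm_replace(4) unfolding lp_optimal_def lp_feasible_set_def by auto
  have "w \<in> B" using B(2)[OF mem_plus_C_imp_dom[OF inv(1)] inv(2)] cm_replace(3) by blast
  moreover have "saturated x' w"
    using lp_optimal_imp_saturated[OF cm_replace(4) x'(2,1)] .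
  moreover have "\<forall>w\<in>W. saturated x' w" using saturated_mono[OF _ x'(2)] inv(4) by blast
  ultimately show ?thesis using inv(1,3) x'(2) cm_replace(2,6) by auto
next
  case (cm_return N W x)
  then have inv: "y \<in> F x + C" "minimal_normal_system (F x + C) N" "\<forall>w\<in>W. saturated x w"
    using assms(2) by auto
  then have "is_minimizer F C x"
    using saturated_imp_minimizer[OF mem_plus_C_imp_dom[OF inv(1)] inv(2)] cm_return(3) by blast
  then show ?thesis using inv(1) cm_return(2) by simp
qed

lemma cm_step_measure:
  assumes "compute_minimizer_step F C c c'" "cm_inv B y c"
  shows "cm_measure B c' < cm_measure B c"
proof -
  have card_le: "card W \<le> card B" if "cm_inv B y (CM_Loop x N W)" for x N W
    using that B(1) card_mono by auto
  \<comment> \<open>Both loop transitions add a new element of \<open>N \<subseteq> B\<close> to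
    \<open>W\<close>, even when \<open>N\<close> is replaced.\<close>
  have card_insert: "card (insert w W) = card W + 1 \<and> card W < card B"
    if "cm_inv B y (CM_Loop x N W)" "w \<in> N - W" for x N W w
  proof -
    have W: "W \<subseteq> B" "y \<in> F x + C" "minimal_normal_system (F x + C) N"
      using that(1) by auto
    then have "w \<in> B" using B(2)[OF mem_plus_C_imp_dom] that(2) by blast
    then have "W \<subset> B" using that(2) W(1) by blast
    then show ?thesis
      using that(2) B(1) psubset_card_mono finite_subset[OF W(1)] by simp
  qed
  show ?thesis
    using assms
  proof cases
    case (cm_no_optimum w N W x)
    then show ?thesis using card_le[of x N W] assms(2) by simp
  next
    case (cm_keep w N W x x' y')
    then show ?thesis using card_insert[of x N W w] assms(2) by (simp, linarith)
  next
    case (cm_replace w N W x x' y' N')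
    then show ?thesis using card_insert[of x N W w] assms(2) by (simp, linarith)
  next
    case (cm_return N W x)
    then show ?thesis using card_le[of x N W] assms(2) by simp
  qed simp
qed

lemma sb_step_inv:
  assumes "solve_bounded_step F C \<sigma> \<sigma>'" "sb_inv B \<sigma>"
  shows "sb_inv B \<sigma>'"
  using assms
proof cases
  case (sb_next y V S)
  then show ?thesis using assms(2) by auto
next
  case (sb_call c c' V S)
  then show ?thesis using assms(2) cm_step_inv by (simp, blast)
next
  case (sb_collect V S R)
  then show ?thesis using assms(2) by auto
next
  case (sb_output S)
  then show ?thesis using assms(2) is_solutionI by simp
qed

lemma sb_step_measure:
  assumes "solve_bounded_step F C \<sigma> \<sigma>'" "sb_inv B \<sigma>"
  shows "sb_measure B \<sigma>' < sb_measure B \<sigma>"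
  using assms
proof cases
  case (sb_next y V S)
  then have "finite V" using assms(2) finite_vertices finite_subset by auto
  then have "card V = Suc (card (V - {y}))"
    using sb_next(3) by (metis card_Suc_Diff1)
  then show ?thesis using sb_next(1,2) by simp
next
  case (sb_call c c' V S)
  then show ?thesis using assms(2) cm_step_measure by auto
qed simp_all

end

section \<open>Finite runs and correct outputs\<close>

lemma solve_bounded_terminates:
  assumes "s 0 = solve_bounded_start F C" "\<And>i. solve_bounded_step F C (s i) (s (Suc i))"
  shows False
proof -
  obtain B where B: "finite B"
    "\<And>x N. x \<in> set_dom F \<Longrightarrow> minimal_normal_system (F x + C) N \<Longrightarrow> N \<subseteq> B"
    by (rule finite_normals) blast
  have inv: "sb_inv B (s i)" for i
  proof (induction i)
    case 0
    then show ?case using assms(1) by (simp add: solve_bounded_start_def)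
  next
    case (Suc i)
    then show ?case using sb_step_inv[OF B(1) _ assms(2)] B(2) by blast
  qed
  \<comment> \<open>Each step costs at least 1, so more than \<open>sb_measure B (s 0)\<close> steps
    are impossible.\<close>
  have "sb_measure B (s i) + i \<le> sb_measure B (s 0)" for i
  proof (induction i)
    case (Suc i)
    then show ?case using sb_step_measure[OF B(1) _ assms(2)[of i] inv[of i]] B(2) by fastforce
  qed simp
  from this[of "Suc (sb_measure B (s 0))"] show False by simp
qed

lemma solve_bounded_correct:
  assumes "(solve_bounded_step F C)\<^sup>*\<^sup>* (solve_bounded_start F C) \<sigma>"
    and "\<And>\<sigma>'. \<not> solve_bounded_step F C \<sigma> \<sigma>'"
  shows "\<exists>S. \<sigma> = SB_Output S \<and> is_solution F C S"
proof -
  obtain B where B: "finite B"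
    "\<And>x N. x \<in> set_dom F \<Longrightarrow> minimal_normal_system (F x + C) N \<Longrightarrow> N \<subseteq> B"
    by (rule finite_normals) blast
  have "sb_inv B \<sigma>"
    using assms(1)
  proof (induction rule: rtranclp_induct)
    case base
    then show ?case by (simp add: solve_bounded_start_def)
  next
    case (step \<sigma> \<sigma>')
    then show ?case using sb_step_inv[OF B(1) _ step(2,3)] B(2) by blast
  qed
  then show ?thesis using sb_progress assms(2) by blast
qed

end

text \<open>Absence of infinite runs gives termination under all choices; the second conjunct also
  excludes halting before an output.\<close>

theorem proposition4p1:
  fixes F :: "real ^ 'n \<Rightarrow> (real ^ 'q) set" and C :: "(real ^ 'q) set"
  assumes "polyhedral_convex_map F"
    and "polyhedron C" and "convex_cone C"
    and "interior C \<noteq> {}" and "line_free C"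
    and "feasible_problem F" and "bounded_problem F C"
  shows "\<not> (\<exists>s :: nat \<Rightarrow> (real ^ 'n, real ^ 'q) sb_state.
              s 0 = solve_bounded_start F C \<and> (\<forall>i. solve_bounded_step F C (s i) (s (Suc i))))
       \<and> (\<forall>\<sigma>. (solve_bounded_step F C)\<^sup>*\<^sup>* (solve_bounded_start F C) \<sigma>
              \<and> \<not> (\<exists>\<sigma>'. solve_bounded_step F C \<sigma> \<sigma>')
            \<longrightarrow> (\<exists>S. \<sigma> = SB_Output S \<and> is_solution F C S))"
proof -
  interpret bounded_polyhedral_problem F C
    using assms by unfold_locales
  show ?thesis
    using solve_bounded_terminates solve_bounded_correct by blast
qed

end
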